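(* Let $G$ and $\overline{G}$ be a couple of twin $P$ games with $n$ players. There exists exactly one balanced lottery $\mathbf p=(p_1,\dots,p_n)$ on $G$; its probabilities are given by the normalized individual weights of the twin $\overline G$ according to the rule $$p_j=\frac{\overline{w}_{n-j}}{\overline{w}(N)}\quad\text{for } j=1,\dots,n-1,\qquad p_n=\frac{\overline{w}_n}{\overline{w}(N)},$$ while the common probability $\pi$ that a player is a member of the selected minimal winning coalition is $$\pi=\frac{\overline q}{\overline w(N)}=\frac{q}{w(N)}.$$
   Context: **Games.** Let $N=\{1,\dots,n\}$ be a set of players. A simple game is a function $v:\mathcal P(N)\to\{0,1\}$; a coalition $S\subseteq N$ is winning if $v(S)=1$, and minimal winning if $v(S)=1$ and $v(T)=0$ for every $T\subsetneq S$. The game is constant sum if $v(S)+v(N\setminus S)=1$ for all $S$. A player is a dummy if it belongs to no minimal winning coalition, and a dictator if $v(\{j\})=1$; all games considered are free of dummies and dictators. A representation $(q;\mathbf w)$ of a weighted majority game consists of positive weights $w_1,\dots,w_n$ and a quota $q>\tfrac12 w(N)$ such that $v(S)=1\iff w(S)\ge q$, where $w(S)=\sum_{j\in S}w_j$. It is homogeneous if $w(S)=q$ for every minimal winning $S$; a game is a homogeneous weighted majority game if it has a homogeneous representation. Every constant sum homogeneous weighted majority game has a (unique) minimal homogeneous representation: a homogeneous representation with integer weights, minimum weight $1$, and $q=\frac{1+w(N)}{2}$. The minimal winning quota of the game is the $q$ of this representation, and its individual weights are the $w_j$ of this representation. Players are always numbered so that $1=w_1\le w_2\le\dots\le w_n$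 (standard ordering). **$P$ games.** A $P$ game (Parsimonious game) is a constant sum homogeneous weighted majority game with $n>3$ non-dummy players having exactly $n$ minimal winning coalitions (the smallest possible number). Players with the same individual weight are of the same type; types are numbered $t=1,\dots,h$ in strictly increasing order of weight. It is known that $2\le h\le n-2$, that type $h$ contains exactly one player (the top player, $j=n$), and that the minimal winning coalitions are exactly $S_1,\dots,S_n$, where for $j<n$ of type $t$ the coalition $S_j$ consists of $j$ and all players of type $s>t$ with $s-t$ odd, and $S_n$ consists of all players of odd type. **Incidence matrix.** The incidence matrix of a $P$ game is the $n\times n$ binary matrix $A=(a_{ij})$ with $a_{ij}=1$ if $j\in S_i$ and $a_{ij}=0$ otherwise. **Twins.** For any $P$ game $G$ with incidence matrix $A$, it is known that the transpose $A^T$ is again the incidence matrix of a $P$ game $\overline G$, called the twin of $G$, where in $A^T$ the non-top players (columns) and the corresponding coalitions (rows) are listed in the reverse of the standard order, while the top player and its associated coalition remain last. Equivalently, in the standard ordering the incidence matrix of $\overline G$ is $A^\tau$, obtained from $A^T$ by reversing the order of the first $n-1$ rows and of the first $n-1$ columns. Overlined quantities refer to $\overline G$; in particular $(\overline q;\overline w_1,\dots,\overline w_n)$ is the minimal homogeneous representation of $\overline G$ in the standard (non-decreasing) ordering and $\overline w(N)=\sum_{j}\overline w_j$. **Balanced lotteries.** A lottery on an $n$ person $P$ game $G$ is a probability distribution on its minimal winning coalitions, i.e. a column vector $\mathbf p=(p_1,\dots,p_n)$ where $p_j$ is the probability assigned to $S_j$. It is balanced if all players have the same probability $\pi$ of being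 a member of the selected minimal winning coalition, i.e. $\mathbf p^T A=\pi\,\mathbf 1^T$, where $\mathbf 1$ is the all-ones vector. *)

theory Defs
  imports "HOL-Probability.Probability_Mass_Function" "Jordan_Normal_Form.Matrix"
begin

text \<open>The player set is \<open>{1..n}\<close>; the values of \<open>v\<close> outside its subsets are irrelevant.\<close>

definition simple_game :: "nat \<Rightarrow> (nat set \<Rightarrow> nat) \<Rightarrow> bool" where
  "simple_game n v \<longleftrightarrow> (\<forall>S\<subseteq>{1..n}. v S \<in> {0, 1})"

definition minimal_winning :: "nat \<Rightarrow> (nat set \<Rightarrow> nat) \<Rightarrow> nat set \<Rightarrow> bool" where
  "minimal_winning n v S \<longleftrightarrow> S \<subseteq> {1..n} \<and> v S = 1 \<and> (\<forall>T. T \<subset> S \<longrightarrow> v T = 0)"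

definition constant_sum :: "nat \<Rightarrow> (nat set \<Rightarrow> nat) \<Rightarrow> bool" where
  "constant_sum n v \<longleftrightarrow> (\<forall>S\<subseteq>{1..n}. v S + v ({1..n} - S) = 1)"

definition dummy :: "nat \<Rightarrow> (nat set \<Rightarrow> nat) \<Rightarrow> nat \<Rightarrow> bool" where
  "dummy n v j \<longleftrightarrow> (\<forall>S. minimal_winning n v S \<longrightarrow> j \<notin> S)"

definition dictator :: "(nat set \<Rightarrow> nat) \<Rightarrow> nat \<Rightarrow> bool" where
  "dictator v j \<longleftrightarrow> v {j} = 1"

definition representation :: "nat \<Rightarrow> (nat set \<Rightarrow> nat) \<Rightarrow> real \<Rightarrow> (nat \<Rightarrow> real) \<Rightarrow> bool" where
  "representation n v q w \<longleftrightarrow>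
     (\<forall>j\<in>{1..n}. 0 < w j) \<and> q > sum w {1..n} / 2 \<and>
     (\<forall>S\<subseteq>{1..n}. v S = 1 \<longleftrightarrow> sum w S \<ge> q)"

definition homogeneous_representation ::
    "nat \<Rightarrow> (nat set \<Rightarrow> nat) \<Rightarrow> real \<Rightarrow> (nat \<Rightarrow> real) \<Rightarrow> bool" where
  "homogeneous_representation n v q w \<longleftrightarrow>
     representation n v q w \<and> (\<forall>S. minimal_winning n v S \<longrightarrow> sum w S = q)"

definition minimal_homogeneous_representation ::
    "nat \<Rightarrow> (nat set \<Rightarrow> nat) \<Rightarrow> real \<Rightarrow> (nat \<Rightarrow> real) \<Rightarrow> bool" where
  "minimal_homogeneous_representation n v q w \<longleftrightarrow>
     homogeneous_representation n v q w \<and>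
     (\<forall>j\<in>{1..n}. w j \<in> \<int>) \<and> Min (w ` {1..n}) = 1 \<and> q = (1 + sum w {1..n}) / 2"

definition standard_ordering :: "nat \<Rightarrow> (nat \<Rightarrow> real) \<Rightarrow> bool" where
  "standard_ordering n w \<longleftrightarrow> mono_on {1..n} w"

definition P_game :: "nat \<Rightarrow> (nat set \<Rightarrow> nat) \<Rightarrow> bool" where
  "P_game n v \<longleftrightarrow>
     n > 3 \<and> simple_game n v \<and> constant_sum n v \<and>
     (\<exists>q w. homogeneous_representation n v q w) \<and>
     (\<forall>j\<in>{1..n}. \<not> dummy n v j) \<and> (\<forall>j\<in>{1..n}. \<not> dictator v j) \<and>
     card {S. minimal_winning n v S} = n"

text \<open>
  In the next three definitions \<open>w\<close> is meant to be the minimal homogeneous weight vector of a \<open>P\<close> game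
  in the standard ordering.  The type of \<open>j\<close> is the rank of \<open>w j\<close> among the distinct weights, so
  that types are numbered \<open>1, \<dots>, h\<close> in increasing order of weight.
\<close>

definition player_type :: "nat \<Rightarrow> (nat \<Rightarrow> real) \<Rightarrow> nat \<Rightarrow> nat" where
  "player_type n w j = card {x \<in> w ` {1..n}. x \<le> w j}"

definition coalition :: "nat \<Rightarrow> (nat \<Rightarrow> real) \<Rightarrow> nat \<Rightarrow> nat set" where
  "coalition n w j =
     (if j = n then {i \<in> {1..n}. odd (player_type n w i)}
      else insert j {i \<in> {1..n}. player_type n w i > player_type n w j \<and>
                                 odd (player_type n w i - player_type n w j)})"

text \<open>Matrix indices start at \<open>0\<close>, so player \<open>j\<close> and coalition \<open>S\<^sub>j\<close> have index \<open>j - 1\<close>.\<close>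

definition incidence_matrix :: "nat \<Rightarrow> (nat \<Rightarrow> real) \<Rightarrow> real Matrix.mat" where
  "incidence_matrix n w =
     Matrix.mat n n (\<lambda>(i, j). if Suc j \<in> coalition n w (Suc i) then 1 else 0)"

definition reverse_non_top :: "nat \<Rightarrow> nat \<Rightarrow> nat" where
  "reverse_non_top n i = (if i < n - 1 then n - 2 - i else i)"

definition twin_matrix :: "nat \<Rightarrow> real Matrix.mat \<Rightarrow> real Matrix.mat" where
  "twin_matrix n A = Matrix.mat n n
     (\<lambda>(i, j). transpose_mat A $$ (reverse_non_top n i, reverse_non_top n j))"

definition lottery :: "nat \<Rightarrow> (nat set \<Rightarrow> nat) \<Rightarrow> nat set pmf \<Rightarrow> bool" where
  "lottery n v p \<longleftrightarrow> set_pmf p \<subseteq> {S. minimal_winning n v S}"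

definition balanced_lottery ::
    "nat \<Rightarrow> (nat set \<Rightarrow> nat) \<Rightarrow> nat set pmf \<Rightarrow> real \<Rightarrow> bool" where
  "balanced_lottery n v p \<pi> \<longleftrightarrow>
     lottery n v p \<and> (\<forall>j\<in>{1..n}. measure_pmf.prob p {S. j \<in> S} = \<pi>)"

end

theory Submission
  imports Defs
begin

text \<open>
  The lottery is balanced because of \<open>sum_coalition\<close> for the twin: every coalition of the twin has
  weight \<open>q'\<close>, so transposing the incidence matrix makes the reversed weights \<open>w'\<close> a solution of
  \<open>p\<^sup>T A = q' 1\<^sup>T\<close>.  It is the only one because the weights of a parsimonious game are, up to scale,
  the only vector that is constant on its minimal winning coalitions
  (\<open>constant_on_coalitions_proportional\<close>, applied to the twin).  Multiplying \<open>p\<^sup>T A = \<pi> 1\<^sup>T\<close> by \<open>w\<close>,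
  with \<open>A w = q 1\<close>, gives \<open>\<pi> = q / w(N)\<close>.

  What takes work is that the coalitions \<open>S\<^sub>j\<close>, defined through types, are exactly the minimal winning
  coalitions of a game about which only their number \<open>n\<close> is known.  With \<open>q = (1 + w(N)) / 2\<close> the
  minimal winning coalitions are the quota sets, the sets of weight exactly \<open>q\<close>, and the argument is
  as follows.

  Player \<open>1\<close> has weight \<open>1\<close>, so if \<open>S\<close> is a quota set containing \<open>1\<close> then so is
  \<open>S\<^sup>* = (N - S) \<union> {1}\<close>.  These two sets split the other players into two classes of weight \<open>q - 1\<close>.
  Every \<open>i \<noteq> 1\<close> can be completed by a set \<open>X i\<close> from the opposite class to a quota set
  \<open>T i = {i} \<union> X i\<close>, and \<open>T i = T j\<close> with \<open>i \<noteq> j\<close> forces \<open>T i = {i, j}\<close>.  Two such pairs would be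
  disjoint or share a player, and both are impossible; hence \<open>S\<close>, \<open>S\<^sup>*\<close> and the \<open>T i\<close> are at least \<open>n\<close> sets.
  When there are only \<open>n\<close> quota sets, there is exactly one coincidence \<open>T a = T b = {a, b}\<close> and no
  further quota set (\<open>ex_split\<close>).  This knowledge of all quota sets shows that \<open>X i\<close> consists of the
  heavier players of the opposite class (\<open>X_eq\<close>), for every \<open>i\<close> but the top player.

  Consequently two players of neighbouring types belong to opposite classes: otherwise they would
  have the same \<open>X\<close> and hence the same weight.  So the classes alternate with the types, membership
  in \<open>S\<close> is oddness of the type (\<open>odd_type_iff\<close>), and \<open>S\<close>, \<open>S\<^sup>*\<close>, \<open>T i\<close> become the \<open>S\<^sub>j\<close>
  (\<open>image_coalition\<close>).  Finally, exchanging \<open>T i\<close> for \<open>{1}\<close> with the class opposite to \<open>i\<close> expresses a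
  vector constant on quota sets at \<open>i\<close> through its values at lighter players, which gives the
  uniqueness of \<open>w\<close> up to scale.
\<close>

section \<open>Coalitions whose weight is exactly the quota\<close>

definition quota_sets :: "nat \<Rightarrow> (nat \<Rightarrow> real) \<Rightarrow> real \<Rightarrow> nat set set" where
  "quota_sets n w q = {S. S \<subseteq> {1..n} \<and> sum w S = q}"

text \<open>
  The arithmetic content of a parsimonious game with its minimal homogeneous representation.
  The assumption \<open>quota_subset\<close> is homogeneity: every winning coalition contains one of weight
  exactly \<open>q\<close>.
\<close>

locale parsimonious_weights =
  fixes n :: nat and w :: "nat \<Rightarrow> real" and q :: real
  assumes n_gt_3: "n > 3"
    and w_1: "w 1 = 1"
    and w_mono: "mono_on {1..n} w"
    and quota: "2 * q = 1 + sum w {1..n}"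
    and quota_subset: "\<And>S. S \<subseteq> {1..n} \<Longrightarrow> q \<le> sum w S \<Longrightarrow> \<exists>T\<subseteq>S. T \<in> quota_sets n w q"
    and ex_quota_set_1: "\<exists>S \<in> quota_sets n w q. 1 \<in> S"
    and card_quota_sets: "card (quota_sets n w q) = n"

text \<open>
  For a quota set \<open>S\<close> containing player \<open>1\<close>, the players other than \<open>1\<close> fall into the classes \<open>S - {1}\<close>
  and \<open>N - S\<close>; naming a class by any player of the other one treats both at once.
\<close>

definition opposite_class :: "nat \<Rightarrow> nat set \<Rightarrow> nat \<Rightarrow> nat set" where
  "opposite_class n S i = {j \<in> {2..n}. (j \<in> S) \<noteq> (i \<in> S)}"

text \<open>
  The complete list of the quota sets that counting enforces.  The set \<open>S\<close> is the one of the two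
  quota sets containing \<open>1\<close> that also contains \<open>2\<close>, so that it will consist of the players of odd
  type; \<open>a\<close> will be the top player.
\<close>

locale split_weights = parsimonious_weights +
  fixes S :: "nat set" and X :: "nat \<Rightarrow> nat set" and a b :: nat
  assumes S: "S \<in> quota_sets n w q" "1 \<in> S" "2 \<in> S"
    and X: "\<And>i. i \<in> {2..n} \<Longrightarrow> X i \<subseteq> opposite_class n S i \<and> insert i (X i) \<in> quota_sets n w q"
    and quota_sets_eq: "quota_sets n w q =
      {S, insert 1 ({1..n} - S)} \<union> (\<lambda>i. insert i (X i)) ` {2..n}"
    and ab: "a \<in> {2..n}" "b \<in> {2..n}" "X a = {b}" "X b = {a}" "w b < w a"

context parsimonious_weights
begin

lemma w_ge_1: "i \<in> {1..n} \<Longrightarrow> 1 \<le> w i"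
  using mono_onD[OF w_mono, of 1 i] w_1 n_gt_3 by auto

lemma sum_w_mono: "T \<subseteq> U \<Longrightarrow> U \<subseteq> {1..n} \<Longrightarrow> sum w T \<le> sum w U"
proof (rule sum_mono2)
  assume "T \<subseteq> U" "U \<subseteq> {1..n}"
  thus "finite U" by (auto intro: finite_subset)
  show "0 \<le> w i" if "i \<in> U - T" for i
    using w_ge_1[of i] that \<open>U \<subseteq> {1..n}\<close> by auto
qed

lemma w_le_sum: "i \<in> U \<Longrightarrow> U \<subseteq> {1..n} \<Longrightarrow> w i \<le> sum w U"
  using sum_w_mono[of "{i}" U] by auto

lemma sum_complement: "T \<subseteq> {1..n} \<Longrightarrow> sum w ({1..n} - T) = 2 * q - 1 - sum w T"
  using quota by (simp add: sum_diff)

lemma finite_quota_set: "T \<in> quota_sets n w q \<Longrightarrow> finite T"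
  by (auto simp: quota_sets_def intro: finite_subset)

text \<open>Two disjoint quota sets would weigh \<open>2 * q\<close>, more than all players together.\<close>

lemma quota_sets_intersect:
  assumes "T \<in> quota_sets n w q" "U \<in> quota_sets n w q"
  shows "T \<inter> U \<noteq> {}"
proof
  assume "T \<inter> U = {}"
  hence "U \<subseteq> {1..n} - T" using assms by (auto simp: quota_sets_def)
  hence "sum w U \<le> sum w ({1..n} - T)" by (rule sum_w_mono) auto
  thus False using assms sum_complement[of T] by (auto simp: quota_sets_def)
qed

text \<open>
  The complement of a winning coalition just misses the quota, so adding back any member \<open>i\<close> of
  \<open>T\<close> makes it winning; the quota set inside meets \<open>T\<close>, and can do so only in \<open>i\<close>.
\<close>

lemma quota_set_meeting_once:
  assumes T: "T \<in> quota_sets n w q" and i: "i \<in> T"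
  shows "\<exists>U \<in> quota_sets n w q. T \<inter> U = {i}"
proof -
  have sub: "T \<subseteq> {1..n}" using T by (auto simp: quota_sets_def)
  have "sum w (insert i ({1..n} - T)) = w i + sum w ({1..n} - T)"
    using i by (subst sum.insert) auto
  also have "\<dots> = q - 1 + w i"
    using sum_complement[OF sub] T by (simp add: quota_sets_def)
  also have "\<dots> \<ge> q" using w_ge_1 i sub by auto
  finally obtain U where U: "U \<subseteq> insert i ({1..n} - T)" "U \<in> quota_sets n w q"
    using quota_subset[of "insert i ({1..n} - T)"] i sub by blast
  then show ?thesis using quota_sets_intersect[OF T U(2)] i by blast
qed

text \<open>Weight \<open>1\<close> is exactly what the complement of a quota set lacks.\<close>

lemma complement_insert_1:
  assumes "T \<in> quota_sets n w q" "1 \<in> T"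
  shows "insert 1 ({1..n} - T) \<in> quota_sets n w q"
proof -
  have "sum w (insert 1 ({1..n} - T)) = q"
    using assms sum_complement[of T] w_1 by (subst sum.insert) (auto simp: quota_sets_def)
  thus ?thesis using n_gt_3 by (auto simp: quota_sets_def)
qed

lemma ex_quota_set_1_2: "\<exists>S \<in> quota_sets n w q. 1 \<in> S \<and> 2 \<in> S"
proof -
  obtain S where S: "S \<in> quota_sets n w q" "1 \<in> S" using ex_quota_set_1 by blast
  show ?thesis
  proof (cases "2 \<in> S")
    case False
    hence "2 \<in> insert 1 ({1..n} - S)" using n_gt_3 by simp
    then show ?thesis using complement_insert_1[OF S] by blast
  qed (use S in blast)
qed

lemma opposite_class_cases:
  assumes "S \<in> quota_sets n w q" "1 \<in> S" "i \<in> {2..n}"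
  shows "opposite_class n S i = (if i \<in> S then {1..n} - S else S - {1})"
proof -
  have "2 \<le> k \<longleftrightarrow> k \<noteq> 1 \<and> 1 \<le> k" for k :: nat by auto
  thus ?thesis using assms by (auto simp: opposite_class_def quota_sets_def)
qed

lemma insert_1_opposite_class:
  assumes "S \<in> quota_sets n w q" "1 \<in> S" "i \<in> {2..n}"
  shows "insert 1 (opposite_class n S i) \<in> quota_sets n w q"
  using opposite_class_cases[OF assms] complement_insert_1[OF assms(1,2)] assms(1)
    insert_Diff[OF assms(2)]
  by simp

text \<open>
  Apply \<open>quota_set_meeting_once\<close> to the union of \<open>{1}\<close> with the class of \<open>i\<close>: what the resulting
  quota set has besides \<open>i\<close> lies outside that union, hence in the opposite class.
\<close>

lemma ex_X:
  assumes "S \<in> quota_sets n w q" "1 \<in> S" "i \<in> {2..n}"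
  shows "\<exists>X \<subseteq> opposite_class n S i. insert i X \<in> quota_sets n w q"
proof -
  let ?O = "opposite_class n S i"
  let ?T = "insert 1 ({2..n} - ?O)"
  have "insert 1 (opposite_class n S i) \<in> quota_sets n w q"
    by (rule insert_1_opposite_class[OF assms])
  moreover have eq: "insert 1 ({1..n} - insert 1 ?O) = ?T" by auto
  ultimately have "?T \<in> quota_sets n w q" by (metis complement_insert_1 insertI1)
  moreover have "i \<in> ?T" using assms by (auto simp: opposite_class_def)
  ultimately obtain U where U: "U \<in> quota_sets n w q" "?T \<inter> U = {i}"
    using quota_set_meeting_once by blast
  have "i \<noteq> 1" using assms by auto
  hence "U - {i} \<subseteq> ?O" using U by (force simp: quota_sets_def)
  moreover have "insert i (U - {i}) = U" using U by auto
  ultimately show ?thesis using U(1) by metis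
qed

text \<open>
  If the weights agreed, exchanging \<open>a\<close> and \<open>b\<close> in \<open>{1}\<close> together with the class of \<open>a\<close> would give a
  quota set containing \<open>1\<close>.  It contains \<open>b\<close>, so by assumption it is \<open>{1}\<close> with the class of \<open>b\<close>,
  which leaves no players besides \<open>1\<close>, \<open>a\<close> and \<open>b\<close>.
\<close>

lemma opposite_players_weight_neq:
  assumes S: "S \<in> quota_sets n w q" "1 \<in> S" and a: "a \<in> {2..n}" and b: "b \<in> opposite_class n S a"
    and eq: "\<And>U. U \<in> quota_sets n w q \<Longrightarrow> 1 \<in> U \<Longrightarrow> U = S \<or> U = insert 1 ({1..n} - S)"
  shows "w a \<noteq> w b"
proof
  assume w: "w a = w b"
  let ?A = "insert 1 (opposite_class n S b)"
  have b2: "b \<in> {2..n}" using b by (auto simp: opposite_class_def)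
  have aA: "a \<in> ?A" "b \<notin> ?A" "a \<noteq> 1" "a \<noteq> b" using a b by (auto simp: opposite_class_def)
  have A: "?A \<in> quota_sets n w q" by (rule insert_1_opposite_class[OF S b2])
  have fin: "finite ?A" using A by (rule finite_quota_set)
  let ?U = "insert b (?A - {a})"
  have "sum w ?U = w b + (sum w ?A - w a)"
    using aA fin by (subst sum.insert) (auto simp: sum_diff1)
  hence U: "?U \<in> quota_sets n w q" using A w b2 by (auto simp: quota_sets_def)
  have "1 \<in> ?U" using aA by auto
  from eq[OF U this] have U_cases: "?U = S \<or> ?U = insert 1 ({1..n} - S)" .
  have cl: "k \<in> V \<longleftrightarrow> (k \<in> S \<longleftrightarrow> b \<in> S)"
    if "V = S \<or> V = insert 1 ({1..n} - S)" "b \<in> V" "k \<in> {2..n}" for k V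
    using that b2 by auto
  have "k \<in> {a, b}" if "k \<in> {2..n}" for k
    using cl[OF U_cases _ that] that a b b2 aA by (auto simp: opposite_class_def)
  hence "{2..n} \<subseteq> {a, b}" by blast
  hence "card {2..n} \<le> card {a, b}" by (rule card_mono[rotated]) simp
  also have "\<dots> \<le> 2" by (simp add: card_insert_if)
  finally show False using n_gt_3 by simp
qed

text \<open>
  The counting argument.  Besides \<open>S\<close> and its partner only \<open>n - 2\<close> quota sets remain for the
  \<open>n - 1\<close> sets \<open>T i\<close>, so two of these coincide; without \<open>a\<close> the map \<open>T\<close> is injective, so the \<open>T i\<close> exhaust
  the remaining quota sets.
\<close>

lemma ex_split: "\<exists>S X a b. split_weights n w q S X a b"
proof -
  obtain S where S: "S \<in> quota_sets n w q" "1 \<in> S" "2 \<in> S" using ex_quota_set_1_2 by blast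
  obtain X where X: "\<And>i. i \<in> {2..n} \<Longrightarrow> X i \<subseteq> opposite_class n S i \<and> insert i (X i) \<in> quota_sets n w q"
    using ex_X[OF S(1,2)] by metis
  define T where "T i = insert i (X i)" for i
  let ?S' = "insert 1 ({1..n} - S)"
  let ?Q = "quota_sets n w q"
  have S': "?S' \<in> ?Q" by (rule complement_insert_1[OF S(1,2)])
  have "2 \<notin> ?S'" using S by auto
  hence neq: "S \<noteq> ?S'" using S by blast
  have fin: "finite ?Q" using card_quota_sets n_gt_3 by (metis card.infinite not_less_zero)
  have no1: "1 \<notin> T i" if "i \<in> {2..n}" for i
    using X[OF that] that by (auto simp: T_def opposite_class_def)
  have TQ: "T ` {2..n} \<subseteq> ?Q" using X by (auto simp: T_def)
  have card_rest: "card (?Q - {S, ?S'}) = n - 2"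
    using S S' neq fin card_quota_sets by (simp add: card_Diff_subset)
  have rest: "T ` {2..n} \<subseteq> ?Q - {S, ?S'}" using TQ no1 S by blast
  have "card (T ` {2..n}) \<le> n - 2" using card_mono[OF _ rest] fin card_rest by simp
  hence "\<not> inj_on T {2..n}" using card_image[of T "{2..n}"] n_gt_3 by auto
  then obtain a b where ab: "a \<in> {2..n}" "b \<in> {2..n}" "a \<noteq> b" "T a = T b"
    by (auto simp: inj_on_def)
  have pair: "X i = {j} \<and> X j = {i} \<and> (i \<in> S) \<noteq> (j \<in> S)"
    if "i \<in> {2..n}" "j \<in> {2..n}" "i \<noteq> j" "T i = T j" for i j
  proof -
    have sub: "X i \<subseteq> opposite_class n S i" "X j \<subseteq> opposite_class n S j"
      using X that by auto
    have eq: "insert i (X i) = insert j (X j)" using that by (simp add: T_def)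
    hence j: "j \<in> X i" and i: "i \<in> X j" using that(3) by auto
    hence "opposite_class n S i \<inter> opposite_class n S j = {}"
      using sub by (auto simp: opposite_class_def)
    hence "X i = {j}" "X j = {i}" using eq sub i j by blast+
    thus ?thesis using sub by (auto simp: opposite_class_def)
  qed
  \<comment> \<open>A second coinciding pair would have to meet the first one.\<close>
  have inj: "inj_on T ({2..n} - {a})"
  proof (rule inj_onI, rule ccontr)
    fix i j assume ij: "i \<in> {2..n} - {a}" "j \<in> {2..n} - {a}" "T i = T j" "i \<noteq> j"
    have "X i = {j}" "X j = {i}" "X a = {b}" "X b = {a}"
      using pair[of i j] pair[of a b] ij ab by auto
    moreover have "T i \<inter> T a \<noteq> {}" using quota_sets_intersect TQ ij ab by blast
    ultimately show False using ij ab by (auto simp: T_def)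
  qed
  have "card (T ` ({2..n} - {a})) = n - 2" using card_image[OF inj] ab by simp
  moreover have "T ` ({2..n} - {a}) \<subseteq> ?Q - {S, ?S'}" using rest by blast
  ultimately have "T ` ({2..n} - {a}) = ?Q - {S, ?S'}"
    using card_subset_eq fin card_rest by (metis finite_Diff)
  moreover have "T ` ({2..n} - {a}) \<subseteq> T ` {2..n}" by (rule image_mono) simp
  ultimately have "T ` {2..n} = ?Q - {S, ?S'}" using rest by (metis subset_antisym)
  moreover have "{S, ?S'} \<subseteq> ?Q" using S(1) S' by simp
  ultimately have Q: "?Q = {S, ?S'} \<union> T ` {2..n}" by (simp only: Un_Diff_cancel Un_absorb1)
  have b: "b \<in> opposite_class n S a" using pair[OF ab] ab by (auto simp: opposite_class_def)
  have "w a \<noteq> w b"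
  proof (rule opposite_players_weight_neq[OF S(1,2) ab(1) b])
    fix U assume "U \<in> ?Q" "1 \<in> U"
    moreover from this have "U \<notin> T ` {2..n}" using no1 by blast
    ultimately show "U = S \<or> U = ?S'" using Q by blast
  qed
  then consider "w b < w a" | "w a < w b" by linarith
  thus ?thesis
  proof cases
    case 1
    have "split_weights n w q S X a b"
      using S X Q[unfolded T_def] pair[OF ab] ab 1 by unfold_locales blast+
    thus ?thesis by blast
  next
    case 2
    have "split_weights n w q S X b a"
      using S X Q[unfolded T_def] pair[OF ab] ab 2 by unfold_locales blast+
    thus ?thesis by blast
  qed
qed

end

section \<open>Types and classes\<close>

text \<open>
  A property that holds at the lowest type and flips from each type to the next one is oddness of
  the type.
\<close>

lemma odd_player_type_iff:
  fixes w :: "nat \<Rightarrow> real"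
  assumes min: "\<And>k. k \<in> {1..n} \<Longrightarrow> (\<And>l. l \<in> {1..n} \<Longrightarrow> w k \<le> w l) \<Longrightarrow> c k"
    and step: "\<And>k l. k \<in> {1..n} \<Longrightarrow> l \<in> {1..n} \<Longrightarrow> w k < w l \<Longrightarrow>
      (\<And>m. m \<in> {1..n} \<Longrightarrow> \<not> (w k < w m \<and> w m < w l)) \<Longrightarrow> c k \<noteq> c l"
  shows "k \<in> {1..n} \<Longrightarrow> odd (player_type n w k) \<longleftrightarrow> c k"
proof (induction "player_type n w k" arbitrary: k rule: less_induct)
  case (less l)
  show ?case
  proof (cases "\<exists>m\<in>{1..n}. w m < w l")
    case False
    hence le: "w l \<le> w m" if "m \<in> {1..n}" for m using that by force
    hence "{x \<in> w ` {1..n}. x \<le> w l} = {w l}" using less.prems by (auto intro: antisym)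
    thus ?thesis using min[OF less.prems le] by (simp add: player_type_def)
  next
    case True
    let ?M = "{x \<in> w ` {1..n}. x < w l}"
    have "finite ?M" "?M \<noteq> {}" using True by auto
    then obtain k where k: "k \<in> {1..n}" "w k < w l" "w k = Max ?M"
      using Max_in[of ?M] by auto
    have gap: "w m \<le> w k" if "m \<in> {1..n}" "w m < w l" for m
      unfolding k(3) by (rule Max_ge) (use that in auto)
    have "{x \<in> w ` {1..n}. x \<le> w l} = insert (w l) {x \<in> w ` {1..n}. x \<le> w k}"
      using gap k less.prems by force
    hence t: "player_type n w l = Suc (player_type n w k)"
      using k by (simp add: player_type_def)
    moreover have "odd (player_type n w k) \<longleftrightarrow> c k" using less.hyps[of k] k t by simp
    moreover have "c k \<noteq> c l"
      by (rule step[OF k(1) less.prems k(2)]) (use gap in force)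
    ultimately show ?thesis by simp
  qed
qed

lemma player_type_less_iff:
  assumes "i \<in> {1..n}" "j \<in> {1..n}"
  shows "player_type n w j < player_type n w i \<longleftrightarrow> w j < w i"
proof (cases "w j < w i")
  case True
  have "{x \<in> w ` {1..n}. x \<le> w j} \<subset> {x \<in> w ` {1..n}. x \<le> w i}"
    using True assms by force
  thus ?thesis using True by (simp add: player_type_def psubset_card_mono)
next
  case False
  have "{x \<in> w ` {1..n}. x \<le> w i} \<subseteq> {x \<in> w ` {1..n}. x \<le> w j}"
    using False by auto
  hence "player_type n w i \<le> player_type n w j"
    unfolding player_type_def by (intro card_mono) auto
  thus ?thesis using False by simp
qed

context split_weights
begin

abbreviation T where "T i \<equiv> insert i (X i)"

lemma opp: "i \<in> {2..n} \<Longrightarrow> insert 1 (opposite_class n S i) \<in> quota_sets n w q"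
  by (rule insert_1_opposite_class[OF S(1,2)])

text \<open>
  The quota sets \<open>T i\<close> and \<open>{1}\<close> with the class opposite to \<open>i\<close> differ by exchanging \<open>i\<close> for \<open>1\<close> and the
  players that \<open>X i\<close> omits.  For \<open>x = w\<close> this says that the omitted players weigh \<open>w i - 1\<close> together.
\<close>

lemma sum_defect:
  fixes x :: "nat \<Rightarrow> real"
  assumes i: "i \<in> {2..n}" and x: "\<And>U. U \<in> quota_sets n w q \<Longrightarrow> sum x U = r"
  shows "x i = x 1 + sum x (opposite_class n S i - X i)"
proof -
  let ?O = "opposite_class n S i"
  have fin: "finite ?O" by (simp add: opposite_class_def)
  have sub: "X i \<subseteq> ?O" and TQ: "T i \<in> quota_sets n w q" using X[OF i] by auto
  have "i \<notin> X i" "1 \<notin> ?O" using sub by (auto simp: opposite_class_def)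
  moreover have "sum x (T i) = sum x (insert 1 ?O)" using x[OF TQ] x[OF opp[OF i]] by simp
  ultimately have "x i + sum x (X i) = x 1 + sum x ?O"
    using fin finite_subset[OF sub fin] by simp
  thus ?thesis using sum_diff[OF fin sub, of x] by simp
qed

lemma w_less_of_defect:
  assumes i: "i \<in> {2..n}" and j: "j \<in> opposite_class n S i - X i"
  shows "w j < w i"
proof -
  have "w i = w 1 + sum w (opposite_class n S i - X i)"
    by (rule sum_defect[OF i]) (auto simp: quota_sets_def)
  moreover have "w j \<le> sum w (opposite_class n S i - X i)"
    by (rule w_le_sum[OF j]) (auto simp: opposite_class_def)
  ultimately show ?thesis using w_1 by simp
qed

text \<open>
  Omitted players are lighter than \<open>i\<close>, hence have smaller index, and \<open>sum_defect\<close> for \<open>x\<close> and for \<open>w\<close>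
  is the same recursion.
\<close>

lemma constant_on_quota_sets_proportional:
  fixes x :: "nat \<Rightarrow> real"
  assumes x: "\<And>U. U \<in> quota_sets n w q \<Longrightarrow> sum x U = r" and i: "i \<in> {1..n}"
  shows "x i = w i * x 1"
  using i
proof (induction i rule: less_induct)
  case (less i)
  show ?case
  proof (cases "i = 1")
    case False
    hence i: "i \<in> {2..n}" using less.prems by auto
    let ?D = "opposite_class n S i - X i"
    have "x j = w j * x 1" if j: "j \<in> ?D" for j
    proof (rule less.IH)
      show "j \<in> {1..n}" using j by (auto simp: opposite_class_def)
      with w_less_of_defect[OF i j] show "j < i"
        using mono_onD[OF w_mono, of i j] less.prems by force
    qed
    hence "x i = (w 1 + sum w ?D) * x 1"
      using sum_defect[OF i x] w_1 by (simp add: sum_distrib_left algebra_simps)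
    also have "w 1 + sum w ?D = w i"
      using sum_defect[OF i, of w q] by (simp add: quota_sets_def)
    finally show ?thesis .
  qed (use w_1 in simp)
qed

lemma a_neq_b: "a \<noteq> b"
  using ab by auto

lemma opposite_ab: "(a \<in> S) \<noteq> (b \<in> S)"
  using X[OF ab(1)] ab by (auto simp: opposite_class_def)

lemma quota_set_meets_pair: "U \<in> quota_sets n w q \<Longrightarrow> a \<in> U \<or> b \<in> U"
  using quota_sets_intersect[of U "T a"] X[OF ab(1)] ab by auto

text \<open>
  Otherwise take a quota set \<open>U\<close> that meets \<open>T i\<close> only in \<open>j\<close> and look it up in the list of all quota
  sets.  Let \<open>e\<close> be the member of the pair \<open>{a, b}\<close> that lies in \<open>X i\<close>, and \<open>e'\<close> the other one.  As \<open>U\<close>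
  omits \<open>e\<close>, it contains \<open>e'\<close>, which is in the class of \<open>i\<close>.  Since \<open>U\<close> splits the class of \<open>j\<close>, it is
  some \<open>T k\<close>; as \<open>i \<in> X j\<close> rules out \<open>k = j\<close>, player \<open>k\<close> is in the class of \<open>i\<close> and can only be \<open>e'\<close>.
  But \<open>T e' = {a, b}\<close> does not contain \<open>j\<close>.
\<close>

lemma X_antisym:
  assumes i: "i \<in> {2..n}" "i \<notin> {a, b}" and j: "j \<in> {2..n}" "j \<notin> {a, b}"
    and ji: "j \<in> X i" and ij: "i \<in> X j"
  shows False
proof -
  have opp_ij: "(i \<in> S) \<noteq> (j \<in> S)" using X[OF i(1)] ji by (auto simp: opposite_class_def)
  obtain U where U: "U \<in> quota_sets n w q" "T i \<inter> U = {j}"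
    using quota_set_meeting_once[of "T i" j] X[OF i(1)] ji by auto
  have iU: "i \<notin> U" "j \<in> U" using U opp_ij by auto
  have "a \<in> X i \<or> b \<in> X i" using quota_set_meets_pair[of "T i"] X[OF i(1)] i(2) by auto
  moreover have "(k \<in> S) \<noteq> (i \<in> S)" if "k \<in> X i" for k
    using X[OF i(1)] that by (auto simp: opposite_class_def)
  ultimately obtain e e' where e: "e \<in> X i" "e \<in> {a, b}" "e' \<in> {a, b}" "X e' = {e}"
      "(e' \<in> S) = (i \<in> S)"
    using opposite_ab ab(3,4) by (metis insertCI)
  have eU: "e \<notin> U" using U e j by auto
  hence e'U: "e' \<in> U" using quota_set_meets_pair[OF U(1)] e ab a_neq_b by auto
  have e2: "e \<in> {2..n}" "e' \<in> {2..n}" using e ab by auto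
  have "(e \<in> S) \<noteq> (i \<in> S)" using X[OF i(1)] e by (auto simp: opposite_class_def)
  \<comment> \<open>\<open>U\<close> separates \<open>e\<close> from \<open>j\<close>, which lie in the same class.\<close>
  hence "(e \<in> S) = (j \<in> S)" using opp_ij by blast
  moreover have "e \<in> {1..n}" "e \<noteq> 1" "j \<in> {1..n}" "j \<noteq> 1" using e2(1) j(1) by auto
  ultimately have "U \<noteq> S" "U \<noteq> insert 1 ({1..n} - S)" using eU iU(2) by blast+
  then obtain k where k: "k \<in> {2..n}" "U = T k" using U(1) quota_sets_eq by blast
  have "k \<noteq> j" using k iU ij by auto
  hence "j \<in> X k" using k iU by auto
  hence "(k \<in> S) = (e' \<in> S)" using X[OF k(1)] opp_ij e by (auto simp: opposite_class_def)
  hence "e' \<notin> X k" using X[OF k(1)] by (auto simp: opposite_class_def)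
  hence "k = e'" using e'U k by auto
  thus False using \<open>j \<in> X k\<close> e j by auto
qed

text \<open>The set \<open>X b = {a}\<close> omits every other player of the class of \<open>a\<close>.\<close>

lemma w_less_partner:
  assumes "i \<in> {2..n}" "i \<noteq> a" "(i \<in> S) = (a \<in> S)"
  shows "w i < w b"
  by (rule w_less_of_defect[OF ab(2)]) (use assms opposite_ab ab in \<open>auto simp: opposite_class_def\<close>)

lemma w_less_top:
  assumes "i \<in> {1..n}" "i \<noteq> a"
  shows "w i < w a"
proof -
  consider "i = 1" | "i \<in> {2..n}" "(i \<in> S) = (a \<in> S)" | "i \<in> {2..n}" "i \<noteq> b" "(i \<in> S) = (b \<in> S)" | "i = b"
    using assms opposite_ab by fastforce
  thus ?thesis
  proof cases
    case 1 thus ?thesis using w_ge_1[of b] w_1 ab by auto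
  next
    case 2 thus ?thesis using w_less_partner[of i] assms ab by auto
  next
    case 3 show ?thesis
      by (rule w_less_of_defect[OF ab(1)]) (use 3 opposite_ab ab in \<open>auto simp: opposite_class_def\<close>)
  next
    case 4 thus ?thesis using ab by simp
  qed
qed

lemma top_eq_n: "a = n"
proof (rule ccontr)
  assume "a \<noteq> n"
  hence "w n < w a" using w_less_top[of n] n_gt_3 by auto
  thus False using mono_onD[OF w_mono, of a n] ab by force
qed

text \<open>
  A player omitted by \<open>X i\<close> is lighter than \<open>i\<close>.  Conversely, \<open>j \<in> X i\<close> implies \<open>i \<notin> X j\<close> by
  \<open>X_antisym\<close>, so \<open>i\<close> is omitted by \<open>X j\<close> and lighter than \<open>j\<close>; the players \<open>a\<close> and \<open>b\<close>, for which
  \<open>b \<in> X a\<close> and \<open>a \<in> X b\<close>, are treated separately.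
\<close>

lemma X_eq:
  assumes i: "i \<in> {2..n}" "i \<noteq> a"
  shows "X i = {j \<in> opposite_class n S i. w i < w j}"
proof (intro equalityI subsetI)
  fix j assume j: "j \<in> X i"
  hence opp_j: "j \<in> opposite_class n S i" using X[OF i(1)] by auto
  hence j2: "j \<in> {2..n}" and opp_i: "i \<in> opposite_class n S j"
    using i by (auto simp: opposite_class_def)
  have "w i < w j"
  proof -
    consider "j = a" | "j = b" "j \<noteq> a" | "i = b" | "j \<notin> {a, b}" "i \<notin> {a, b}" using i by blast
    thus ?thesis
    proof cases
      case 1 thus ?thesis using w_less_top[of i] i by auto
    next
      case 2 thus ?thesis using w_less_partner[of i] i opp_i opposite_ab
        by (auto simp: opposite_class_def)
    next
      case 3 thus ?thesis using j ab by auto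
    next
      case 4
      hence "i \<notin> X j" using X_antisym[OF i(1) _ j2] j by blast
      thus ?thesis using w_less_of_defect[OF j2] opp_i by blast
    qed
  qed
  with opp_j show "j \<in> {j \<in> opposite_class n S i. w i < w j}" by blast
next
  fix j assume "j \<in> {j \<in> opposite_class n S i. w i < w j}"
  thus "j \<in> X i" using w_less_of_defect[OF i(1), of j] by force
qed

lemma opposite_w_neq:
  assumes i: "i \<in> {2..n}" and j: "j \<in> opposite_class n S i"
  shows "w i \<noteq> w j"
proof
  assume eq: "w i = w j"
  have j2: "j \<in> {2..n}" "i \<noteq> j" using j by (auto simp: opposite_class_def)
  have "i \<noteq> a" using w_less_top[of j] eq j2 by auto
  hence "j \<in> opposite_class n S i - X i" using X_eq[OF i] j eq by auto
  from w_less_of_defect[OF i this] eq show False by simp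
qed

text \<open>
  No player is lighter than player \<open>2\<close> except possibly \<open>1\<close>, so \<open>X 2\<close> omits nobody.  The lowest type
  thus has at least two players, and \<open>2\<close> decides to which class it belongs.
\<close>

lemma w_2: "w 2 = 1"
proof -
  have 2: "2 \<in> {2..n}" using n_gt_3 by auto
  have "j \<in> X 2" if "j \<in> opposite_class n S 2" for j
  proof (rule ccontr)
    assume "j \<notin> X 2"
    hence "w j < w 2" using w_less_of_defect[OF 2] that by blast
    thus False using mono_onD[OF w_mono, of 2 j] that by (force simp: opposite_class_def)
  qed
  hence "opposite_class n S 2 - X 2 = {}" by auto
  hence "sum w (opposite_class n S 2 - X 2) = 0" by (simp only: sum.empty)
  thus ?thesis using sum_defect[OF 2, of w q] w_1 by (simp add: quota_sets_def)
qed

lemma weight_1_in_S: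
  assumes "k \<in> {1..n}" "w k = 1"
  shows "k \<in> S"
proof (rule ccontr)
  assume "k \<notin> S"
  moreover from this have "k \<noteq> 1" using S by metis
  ultimately have "k \<in> opposite_class n S 2" using assms S by (auto simp: opposite_class_def)
  thus False using opposite_w_neq[of 2 k] w_2 assms n_gt_3 by simp
qed

text \<open>
  Players of the same class with neighbouring weights would have the same heavier players in the
  opposite class, hence the same \<open>X\<close> and the same weight.  The top player \<open>a\<close>, to which \<open>X_eq\<close> does
  not apply, is separated from the rest of its class by \<open>b\<close>.
\<close>

lemma consecutive_weights_opposite:
  assumes k: "k \<in> {1..n}" and l: "l \<in> {1..n}" and less: "w k < w l"
    and gap: "\<And>m. m \<in> {1..n} \<Longrightarrow> \<not> (w k < w m \<and> w m < w l)"
  shows "(k \<in> S) \<noteq> (l \<in> S)"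
proof
  assume same: "(k \<in> S) = (l \<in> S)"
  \<comment> \<open>Player \<open>1\<close> has no \<open>X\<close>; player \<open>2\<close> has the same weight and class.\<close>
  define k' where "k' = (if k = 1 then 2 else k)"
  have k': "k' \<in> {2..n}" "w k' = w k" "(k' \<in> S) = (k \<in> S)"
    using k w_1 w_2 S n_gt_3 by (auto simp: k'_def)
  have l2: "l \<in> {2..n}" using less w_ge_1[OF k] w_1 l
    by (cases "l = 1") auto
  have k'a: "k' \<noteq> a" using less w_less_top[of l] l k' by force
  have la: "l \<noteq> a"
  proof
    assume "l = a"
    hence "w k < w b" using w_less_partner[of k'] k' k'a same by auto
    thus False using gap[of b] ab \<open>l = a\<close> by auto
  qed
  have opp_eq: "opposite_class n S k' = opposite_class n S l"
    using same k' by (simp add: opposite_class_def)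
  have "w k' < w j \<longleftrightarrow> w l < w j" if "j \<in> opposite_class n S l" for j
    using gap[of j] opposite_w_neq[OF l2 that] that less k'
    by (auto simp: opposite_class_def)
  hence "X k' = X l" unfolding X_eq[OF k'(1) k'a] X_eq[OF l2 la] opp_eq by auto
  hence "w k' = w l"
    using sum_defect[OF k'(1), of w q] sum_defect[OF l2, of w q] opp_eq
    by (simp add: quota_sets_def)
  thus False using less k' by simp
qed

lemma odd_type_iff: "k \<in> {1..n} \<Longrightarrow> odd (player_type n w k) \<longleftrightarrow> k \<in> S"
proof (rule odd_player_type_iff)
  fix k assume "k \<in> {1..n}" "\<And>l. l \<in> {1..n} \<Longrightarrow> w k \<le> w l"
  thus "k \<in> S" using weight_1_in_S[of k] w_ge_1[of k] w_1 by (metis antisym atLeastAtMost_iff le_trans order_refl)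
qed (use consecutive_weights_opposite in auto)

lemma coalition_top: "coalition n w n = S"
proof -
  have "S \<subseteq> {1..n}" using S(1) by (simp add: quota_sets_def)
  hence "{i \<in> {1..n}. odd (player_type n w i)} = S" using odd_type_iff by blast
  thus ?thesis by (simp add: coalition_def)
qed

lemma coalition_eq:
  assumes "j \<in> {1..n}" "j \<noteq> n"
  shows "coalition n w j = insert j {i \<in> {1..n}. w j < w i \<and> (i \<in> S) \<noteq> (j \<in> S)}"
proof -
  have "player_type n w i > player_type n w j \<and> odd (player_type n w i - player_type n w j) \<longleftrightarrow>
        w j < w i \<and> (i \<in> S) \<noteq> (j \<in> S)" if "i \<in> {1..n}" for i
    using player_type_less_iff[OF that assms(1), of w] odd_type_iff[OF that]
      odd_type_iff[OF assms(1)] by auto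
  thus ?thesis using assms by (auto simp: coalition_def)
qed

lemma coalition_1: "coalition n w 1 = insert 1 ({1..n} - S)"
proof -
  have "w 1 < w i" if "i \<in> {1..n} - S" for i
    using that weight_1_in_S[of i] w_ge_1[of i] w_1 by force
  hence "{i \<in> {1..n}. w 1 < w i \<and> (i \<in> S) \<noteq> (1 \<in> S)} = {1..n} - S" using S(2) by blast
  thus ?thesis using coalition_eq[of 1] n_gt_3 by simp
qed

lemma coalition_middle:
  assumes "j \<in> {2..n}" "j \<noteq> n"
  shows "coalition n w j = T j"
proof -
  have "i \<in> {2..n}" if "i \<in> {1..n}" "w j < w i" for i
  proof -
    have "1 < w i" using w_ge_1[of j] that assms by simp
    hence "i \<noteq> 1" using w_1 by (metis less_irrefl)
    thus ?thesis using that by auto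
  qed
  hence "{i \<in> {1..n}. w j < w i \<and> (i \<in> S) \<noteq> (j \<in> S)} = {i \<in> opposite_class n S j. w j < w i}"
    by (force simp: opposite_class_def)
  also have "\<dots> = X j" using X_eq[of j] assms top_eq_n by simp
  finally show ?thesis using coalition_eq[of j] assms by simp
qed

text \<open>
  Among the \<open>T i\<close> the one of the top player is redundant, as it equals \<open>T b\<close>; this leaves the index
  \<open>n\<close> free for \<open>S\<close>.
\<close>

lemma image_coalition: "coalition n w ` {1..n} = quota_sets n w q"
proof -
  let ?M = "{2..n} - {n}"
  have N: "{1..n} = {1, n} \<union> ?M" and N2: "{2..n} = insert n ?M" using n_gt_3 by auto
  have "T n = T b" "b \<in> ?M" using ab top_eq_n a_neq_b by auto
  hence "insert (T n) (T ` ?M) = T ` ?M" by (intro insert_absorb) (rule rev_image_eqI)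
  moreover have "T ` {2..n} = insert (T n) (T ` ?M)" by (subst N2) (rule image_insert)
  ultimately have "T ` {2..n} = T ` ?M" by (simp only:)
  moreover have "coalition n w ` ?M = T ` ?M"
    by (rule image_cong) (use coalition_middle in auto)
  ultimately have "coalition n w ` {1..n} = {insert 1 ({1..n} - S), S} \<union> T ` {2..n}"
    using coalition_1 coalition_top
    by (subst (1) N) (simp only: image_Un image_insert image_empty)
  thus ?thesis using quota_sets_eq by (simp only: insert_commute)
qed

end

context parsimonious_weights
begin

lemma bij_betw_coalition: "bij_betw (coalition n w) {1..n} (quota_sets n w q)"
proof -
  obtain S X a b where "split_weights n w q S X a b" using ex_split by blast
  hence im: "coalition n w ` {1..n} = quota_sets n w q" by (rule split_weights.image_coalition)
  hence "inj_on (coalition n w) {1..n}"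
    by (intro eq_card_imp_inj_on) (simp_all add: card_quota_sets)
  thus ?thesis using im by (simp add: bij_betw_def)
qed

lemma sum_coalition: "j \<in> {1..n} \<Longrightarrow> sum w (coalition n w j) = q"
  using bij_betw_coalition by (auto simp: bij_betw_def quota_sets_def)

lemma constant_on_coalitions_proportional:
  fixes x :: "nat \<Rightarrow> real"
  assumes "\<And>j. j \<in> {1..n} \<Longrightarrow> sum x (coalition n w j) = r" and "i \<in> {1..n}"
  shows "x i = w i * x 1"
proof -
  obtain S X a b where "split_weights n w q S X a b" using ex_split by blast
  moreover have "sum x U = r" if "U \<in> quota_sets n w q" for U
    using assms(1) that bij_betw_coalition by (metis bij_betw_imp_surj_on imageE)
  ultimately show ?thesis
    using split_weights.constant_on_quota_sets_proportional assms(2) by blast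
qed

lemma coalition_subset: "j \<in> {1..n} \<Longrightarrow> coalition n w j \<subseteq> {1..n}"
  using bij_betw_coalition by (auto simp: bij_betw_def quota_sets_def)

end

section \<open>From parsimonious games to weights\<close>

text \<open>Since weights are positive, a coalition of weight exactly \<open>q\<close> cannot lose a member and still win.\<close>

lemma minimal_winning_eq_quota_sets:
  assumes "simple_game n v" "homogeneous_representation n v q w"
  shows "{S. minimal_winning n v S} = quota_sets n w q"
proof (intro equalityI subsetI)
  fix S assume "S \<in> {S. minimal_winning n v S}"
  thus "S \<in> quota_sets n w q"
    using assms by (auto simp: homogeneous_representation_def quota_sets_def minimal_winning_def)
next
  fix S assume S: "S \<in> quota_sets n w q"
  have rep: "representation n v q w" using assms by (simp add: homogeneous_representation_def)
  have "v T = 0" if T: "T \<subset> S" for T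
  proof -
    have sub: "S \<subseteq> {1..n}" "finite S" using S by (auto simp: quota_sets_def intro: finite_subset)
    obtain i where i: "i \<in> S - T" using T by auto
    have "sum w T < sum w S"
      by (rule sum_strict_mono2[OF sub(2), of T i])
         (use T i sub rep in \<open>force simp: representation_def\<close>)+
    hence "v T \<noteq> 1" using rep S T sub by (auto simp: representation_def quota_sets_def)
    moreover have "v T \<in> {0, 1}"
      using assms(1) subset_trans[OF psubset_imp_subset[OF T] sub(1)] by (simp add: simple_game_def)
    ultimately show ?thesis by simp
  qed
  thus "S \<in> {S. minimal_winning n v S}"
    using S rep by (auto simp: minimal_winning_def quota_sets_def representation_def)
qed

lemma ex_minimal_winning_subset:
  assumes "simple_game n v" "S \<subseteq> {1..n}" "v S = 1"
  shows "\<exists>T\<subseteq>S. minimal_winning n v T"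
proof -
  let ?W = "{T. T \<subseteq> S \<and> v T = 1}"
  have "finite S" using assms(2) by (rule finite_subset) simp
  hence "finite ?W" by simp
  moreover have "S \<in> ?W" using assms(3) by simp
  ultimately have "\<exists>T\<in>?W. \<forall>U\<in>?W. U \<subseteq> T \<longrightarrow> T = U"
    by (intro finite_has_minimal) blast+
  then obtain T where T: "T \<in> ?W" "\<And>U. U \<in> ?W \<Longrightarrow> U \<subseteq> T \<Longrightarrow> T = U" by blast
  have "v U = 0" if "U \<subset> T" for U
  proof -
    have "U \<subseteq> S" using that T by auto
    hence "v U \<noteq> 1" using T(2)[of U] that by auto
    thus ?thesis using \<open>U \<subseteq> S\<close> assms by (auto simp: simple_game_def)
  qed
  hence "minimal_winning n v T" using T(1) assms(2) by (auto simp: minimal_winning_def)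
  thus ?thesis using T(1) by blast
qed

lemma P_game_parsimonious_weights:
  assumes P: "P_game n v" and min: "minimal_homogeneous_representation n v q w"
    and ord: "standard_ordering n w"
  shows "parsimonious_weights n w q"
proof -
  have n: "n > 3" and simple: "simple_game n v" using P by (auto simp: P_game_def)
  have hom: "homogeneous_representation n v q w" and Min: "Min (w ` {1..n}) = 1"
    and quota: "q = (1 + sum w {1..n}) / 2"
    using min by (auto simp: minimal_homogeneous_representation_def)
  have Q: "{S. minimal_winning n v S} = quota_sets n w q"
    by (rule minimal_winning_eq_quota_sets[OF simple hom])
  show ?thesis
  proof
    have "w 1 = Min (w ` {1..n})"
      by (rule Min_eqI[symmetric])
         (use n mono_onD[OF ord[unfolded standard_ordering_def], of 1] in auto)
    thus "w 1 = 1" using Min by simp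
    show "mono_on {1..n} w" using ord by (simp add: standard_ordering_def)
    show "\<exists>T\<subseteq>S. T \<in> quota_sets n w q" if "S \<subseteq> {1..n}" "q \<le> sum w S" for S
    proof -
      have "v S = 1" using hom that
        by (auto simp: homogeneous_representation_def representation_def)
      thus ?thesis using ex_minimal_winning_subset[OF simple that(1)] Q by auto
    qed
    have "\<not> dummy n v 1" using P n by (auto simp: P_game_def)
    thus "\<exists>S \<in> quota_sets n w q. 1 \<in> S" using Q by (auto simp: dummy_def)
    show "card (quota_sets n w q) = n" using P Q by (simp add: P_game_def)
  qed (use n quota in auto)
qed

section \<open>Twins and balanced lotteries\<close>

definition twin_index :: "nat \<Rightarrow> nat \<Rightarrow> nat" where
  "twin_index n i = (if i = n then n else n - i)"

lemma twin_index_in: "i \<in> {1..n} \<Longrightarrow> twin_index n i \<in> {1..n}"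
  by (auto simp: twin_index_def)

lemma twin_index_twin_index: "i \<in> {1..n} \<Longrightarrow> twin_index n (twin_index n i) = i"
  by (auto simp: twin_index_def)

lemma bij_betw_twin_index: "bij_betw (twin_index n) {1..n} {1..n}"
  by (rule bij_betw_byWitness[where f' = "twin_index n"])
     (use twin_index_in in \<open>auto simp only: twin_index_twin_index\<close>)

lemma twin_coalition_iff:
  assumes twins: "incidence_matrix n w' = twin_matrix n (incidence_matrix n w)"
    and i: "i \<in> {1..n}" and j: "j \<in> {1..n}"
  shows "j \<in> coalition n w i \<longleftrightarrow> twin_index n i \<in> coalition n w' (twin_index n j)"
proof -
  have r: "Suc (reverse_non_top n (twin_index n k - 1)) = k"
      "reverse_non_top n (twin_index n k - 1) < n" "twin_index n k - 1 < n"
      "Suc (twin_index n k - 1) = twin_index n k"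
    if "k \<in> {1..n}" for k
    using that by (auto simp: reverse_non_top_def twin_index_def)
  have "incidence_matrix n w' $$ (twin_index n j - 1, twin_index n i - 1) =
        twin_matrix n (incidence_matrix n w) $$ (twin_index n j - 1, twin_index n i - 1)"
    using twins by simp
  thus ?thesis
    using r[OF i] r[OF j] by (simp add: incidence_matrix_def twin_matrix_def split: if_splits)
qed

text \<open>
  A column of the incidence matrix of the game is a row of that of the twin, so summing over the
  coalitions that contain \<open>j\<close> amounts to summing over a coalition of the twin.
\<close>

lemma sum_over_coalitions_containing:
  fixes x :: "nat \<Rightarrow> real"
  assumes twins: "incidence_matrix n w' = twin_matrix n (incidence_matrix n w)"
    and j: "j \<in> {1..n}" and sub: "coalition n w' (twin_index n j) \<subseteq> {1..n}"
  shows "(\<Sum>i | i \<in> {1..n} \<and> j \<in> coalition n w i. x (twin_index n i)) =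
    sum x (coalition n w' (twin_index n j))"
proof (rule sum.reindex_bij_betw)
  show "bij_betw (twin_index n) {i \<in> {1..n}. j \<in> coalition n w i} (coalition n w' (twin_index n j))"
    by (rule bij_betw_byWitness[where f' = "twin_index n"])
       (use sub twin_index_in twin_index_twin_index twin_coalition_iff[OF twins _ j] in
         \<open>force simp: subset_iff\<close>)+
qed

theorem theorem5p1:
  fixes n :: nat
    and v v' :: "nat set \<Rightarrow> nat"
    and q q' :: real
    and w w' :: "nat \<Rightarrow> real"
  assumes "P_game n v"
    and "minimal_homogeneous_representation n v q w"
    and "standard_ordering n w"
    and "P_game n v'"
    and "minimal_homogeneous_representation n v' q' w'"
    and "standard_ordering n w'"
    and twins: "incidence_matrix n w' = twin_matrix n (incidence_matrix n w)"
  shows "(\<exists>!p. \<exists>\<pi>. balanced_lottery n v p \<pi>) \<and>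
    (\<forall>p \<pi>. balanced_lottery n v p \<pi> \<longrightarrow>
       (\<forall>j\<in>{1..n - 1}. pmf p (coalition n w j) = w' (n - j) / sum w' {1..n}) \<and>
       pmf p (coalition n w n) = w' n / sum w' {1..n} \<and>
       \<pi> = q' / sum w' {1..n} \<and>
       \<pi> = q / sum w {1..n})"
proof -
  interpret G: parsimonious_weights n w q by (rule P_game_parsimonious_weights) fact+
  interpret G': parsimonious_weights n w' q' by (rule P_game_parsimonious_weights) fact+
  let ?N = "{1..n}"
  let ?r = "twin_index n"
  let ?C = "coalition n w"
  let ?C' = "coalition n w'"
  have MW: "{S. minimal_winning n v S} = quota_sets n w q"
    using assms(1,2) by (intro minimal_winning_eq_quota_sets)
      (auto simp: P_game_def minimal_homogeneous_representation_def)
  have C: "?C ` ?N = quota_sets n w q" and inj_C: "inj_on ?C ?N"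
    using G.bij_betw_coalition by (auto simp: bij_betw_def)
  have C': "?C' (?r j) \<subseteq> ?N" "sum w' (?C' (?r j)) = q'" if "j \<in> ?N" for j
    using G'.coalition_subset G'.sum_coalition twin_index_in[OF that] by auto
  have W_pos: "sum w ?N > 0" "sum w' ?N > 0"
    using G.w_le_sum[of 1 ?N] G.w_1 G'.w_le_sum[of 1 ?N] G'.w_1 G.n_gt_3 by auto

  have prob_eq: "measure_pmf.prob p {S. j \<in> S} = (\<Sum>i | i \<in> ?N \<and> j \<in> ?C i. pmf p (?C i))"
    if p: "set_pmf p \<subseteq> ?C ` ?N" for p j
  proof -
    have fin: "finite (?C ` {i \<in> ?N. j \<in> ?C i})" by simp
    have "measure_pmf.prob p {S. j \<in> S} = measure_pmf.prob p (?C ` {i \<in> ?N. j \<in> ?C i})"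
      by (rule measure_pmf.finite_measure_eq_AE) (use p in \<open>auto simp: AE_measure_pmf_iff\<close>)
    also have "\<dots> = sum (pmf p) (?C ` {i \<in> ?N. j \<in> ?C i})"
      by (rule measure_measure_pmf_finite[OF fin])
    also have "\<dots> = (\<Sum>i | i \<in> ?N \<and> j \<in> ?C i. pmf p (?C i))"
      by (subst sum.reindex) (auto intro: inj_on_subset[OF inj_C])
    finally show ?thesis .
  qed

  have unique: "(\<forall>i\<in>?N. pmf p (?C i) = w' (?r i) / sum w' ?N) \<and>
      \<pi> = q' / sum w' ?N \<and> \<pi> = q / sum w ?N"
    if bal: "balanced_lottery n v p \<pi>" for p \<pi>
  proof -
    have supp: "set_pmf p \<subseteq> ?C ` ?N"
      using bal MW C by (auto simp: balanced_lottery_def lottery_def)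
    have inc: "(\<Sum>i | i \<in> ?N \<and> j \<in> ?C i. pmf p (?C i)) = \<pi>" if "j \<in> ?N" for j
      using prob_eq[OF supp, of j] bal that by (simp add: balanced_lottery_def)
    have total: "(\<Sum>i\<in>?N. pmf p (?C i)) = 1"
      using sum_pmf_eq_1[OF _ supp] sum.reindex[OF inj_C, of "pmf p"] by simp
    define x where "x k = pmf p (?C (?r k))" for k
    have x_r: "pmf p (?C i) = x (?r i)" if "i \<in> ?N" for i
      using that by (simp add: x_def twin_index_twin_index)
    have x_sum: "sum x (?C' (?r j)) = \<pi>" if j: "j \<in> ?N" for j
      using sum_over_coalitions_containing[OF twins j C'(1)[OF j], of x] inc[OF j] x_r by simp
    define c where "c = x 1"
    have x_prop: "x k = w' k * c" if k: "k \<in> ?N" for k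
      unfolding c_def
    proof (rule G'.constant_on_coalitions_proportional[OF _ k])
      show "sum x (?C' j) = \<pi>" if "j \<in> ?N" for j
        using x_sum[OF twin_index_in[OF that]] twin_index_twin_index[OF that] by simp
    qed
    have "1 = (\<Sum>i\<in>?N. x (?r i))" using total x_r by simp
    also have "\<dots> = sum x ?N" by (rule sum.reindex_bij_betw[OF bij_betw_twin_index])
    also have "\<dots> = sum w' ?N * c" using x_prop by (simp add: sum_distrib_right)
    finally have c: "c = 1 / sum w' ?N" using W_pos by (simp add: field_simps)
    have 1: "1 \<in> ?N" using G.n_gt_3 by simp
    have "sum x (?C' (?r 1)) = (\<Sum>k\<in>?C' (?r 1). w' k * c)"
      by (rule sum.cong[OF refl]) (use x_prop C'(1)[OF 1] in blast)
    also have "\<dots> = q' * c" using C'(2)[OF 1] by (simp add: sum_distrib_right[symmetric])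
    finally have pi': "\<pi> = q' / sum w' ?N" using c x_sum[OF 1] by simp
    \<comment> \<open>Count the expected weight of the selected coalition, which is always \<open>q\<close>, by players.\<close>
    have "\<pi> * sum w ?N = (\<Sum>j\<in>?N. w j * (\<Sum>i | i \<in> ?N \<and> j \<in> ?C i. pmf p (?C i)))"
      using inc by (simp add: sum_distrib_left mult.commute)
    also have "\<dots> = (\<Sum>j\<in>?N. \<Sum>i | i \<in> ?N \<and> j \<in> ?C i. w j * pmf p (?C i))"
      by (simp add: sum_distrib_left)
    also have "\<dots> = (\<Sum>i\<in>?N. \<Sum>j | j \<in> ?N \<and> j \<in> ?C i. w j * pmf p (?C i))"
      by (rule sum.swap_restrict) auto
    also have "\<dots> = (\<Sum>i\<in>?N. q * pmf p (?C i))"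
    proof (rule sum.cong)
      fix i assume i: "i \<in> ?N"
      have "{j \<in> ?N. j \<in> ?C i} = ?C i" using G.coalition_subset[OF i] by auto
      thus "(\<Sum>j | j \<in> ?N \<and> j \<in> ?C i. w j * pmf p (?C i)) = q * pmf p (?C i)"
        using G.sum_coalition[OF i] by (simp add: sum_distrib_right[symmetric])
    qed simp
    also have "\<dots> = q" using total by (simp add: sum_distrib_left[symmetric])
    finally have pi: "\<pi> = q / sum w ?N" using W_pos by (simp add: field_simps)
    show ?thesis using x_r x_prop[OF twin_index_in] c pi pi' by simp
  qed

  have exists: "\<exists>p. balanced_lottery n v p (q' / sum w' ?N)"
  proof -
    define f where "f i = (if i \<in> ?N then w' (?r i) / sum w' ?N else 0)" for i
    have f_nonneg: "0 \<le> f i" for i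
      using G'.w_ge_1[OF twin_index_in, of i] W_pos by (auto simp: f_def intro!: divide_nonneg_pos)
    have f_sum: "sum f ?N = 1"
    proof -
      have "sum f ?N = (\<Sum>i\<in>?N. w' (?r i)) / sum w' ?N"
        by (simp add: f_def sum_divide_distrib)
      also have "(\<Sum>i\<in>?N. w' (?r i)) = sum w' ?N"
        by (rule sum.reindex_bij_betw[OF bij_betw_twin_index])
      finally show ?thesis using W_pos by simp
    qed
    define P where "P = embed_pmf f"
    have "(\<integral>\<^sup>+ i. ennreal (f i) \<partial>count_space UNIV) = (\<integral>\<^sup>+ i. ennreal (f i) \<partial>count_space ?N)"
      by (rule nn_integral_count_space_eq) (auto simp: f_def)
    also have "\<dots> = 1"
      using f_sum f_nonneg by (simp add: nn_integral_count_space_finite)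
    finally have pmf_P: "pmf P i = f i" for i
      unfolding P_def by (intro pmf_embed_pmf f_nonneg)
    have supp_P: "set_pmf P \<subseteq> ?N"
      by (auto simp: set_pmf_eq pmf_P f_def split: if_splits)
    define p where "p = map_pmf ?C P"
    have supp: "set_pmf p \<subseteq> ?C ` ?N" using supp_P by (auto simp: p_def)
    have "measure_pmf.prob p {S. j \<in> S} = q' / sum w' ?N" if j: "j \<in> ?N" for j
    proof -
      have "measure_pmf.prob p {S. j \<in> S} = measure_pmf.prob P {i. j \<in> ?C i}"
        by (simp add: p_def vimage_def)
      also have "\<dots> = measure_pmf.prob P {i \<in> ?N. j \<in> ?C i}"
        by (rule measure_pmf.finite_measure_eq_AE) (use supp_P in \<open>auto simp: AE_measure_pmf_iff\<close>)
      also have "\<dots> = (\<Sum>i | i \<in> ?N \<and> j \<in> ?C i. f i)"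
        by (subst measure_measure_pmf_finite) (auto simp: pmf_P)
      also have "\<dots> = (\<Sum>i | i \<in> ?N \<and> j \<in> ?C i. w' (?r i)) / sum w' ?N"
        by (simp add: f_def sum_divide_distrib)
      also have "\<dots> = q' / sum w' ?N"
        using sum_over_coalitions_containing[OF twins j C'(1)[OF j], of w'] C'(2)[OF j] by simp
      finally show ?thesis .
    qed
    hence "balanced_lottery n v p (q' / sum w' ?N)"
      using supp MW C by (simp add: balanced_lottery_def lottery_def)
    thus ?thesis by blast
  qed

  have "p1 = p2" if "balanced_lottery n v p1 \<pi>1" "balanced_lottery n v p2 \<pi>2" for p1 p2 \<pi>1 \<pi>2
  proof (rule pmf_eqI)
    fix S
    show "pmf p1 S = pmf p2 S"
    proof (cases "S \<in> ?C ` ?N")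
      case True thus ?thesis using unique[OF that(1)] unique[OF that(2)] by auto
    next
      case False
      hence "S \<notin> set_pmf p1" "S \<notin> set_pmf p2"
        using that MW C by (auto simp: balanced_lottery_def lottery_def)
      thus ?thesis by (simp add: set_pmf_eq)
    qed
  qed
  hence "\<exists>!p. \<exists>\<pi>. balanced_lottery n v p \<pi>" using exists by metis
  moreover have "(\<forall>j\<in>{1..n - 1}. pmf p (?C j) = w' (n - j) / sum w' ?N) \<and>
      pmf p (?C n) = w' n / sum w' ?N \<and> \<pi> = q' / sum w' ?N \<and> \<pi> = q / sum w ?N"
    if "balanced_lottery n v p \<pi>" for p \<pi>
  proof (intro conjI ballI)
    note u = unique[OF that]
    show "pmf p (?C j) = w' (n - j) / sum w' ?N" if "j \<in> {1..n - 1}" for j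
    proof -
      have "j \<in> ?N" "?r j = n - j" using that by (auto simp: twin_index_def)
      thus ?thesis using u by metis
    qed
    have "n \<in> ?N" "?r n = n" using G.n_gt_3 by (auto simp: twin_index_def)
    thus "pmf p (?C n) = w' n / sum w' ?N" using u by metis
    show "\<pi> = q' / sum w' ?N" "\<pi> = q / sum w ?N" using u by blast+
  qed
  ultimately show ?thesis by blast
qed

end
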